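(* Let $G$ be a finite simple loopless graph which is neither complete nor independent (i.e. $G$ has at least one edge and at least one pair of distinct non-adjacent vertices). Then $G$ is representable in $\mathbb{R}^{|G|-2}$, where $|G|$ denotes the number of vertices of $G$.
   Context: A graph $G$ (identified with its vertex set) is called representable in $\mathbb{R}^n$ if there is a map $f$ from the vertex set of $G$ into the Euclidean space $\mathbb{R}^n$ such that for all pairs of distinct vertices $\{x,x'\}$ and $\{y,y'\}$, $\|f(x)-f(x')\| = \|f(y)-f(y')\|$ if and only if $\{x,x'\}$ and $\{y,y'\}$ are both edges or both non-edges of $G$. Here $\|\cdot\|$ is the Euclidean norm. *)

theory Defs
  imports "HOL-Analysis.Analysis" "Graph_Theory.Pair_Digraph"
begin

text \<open>
  A finite simple loopless graph is a \<^locale>\<open>pair_graph\<close>: finitely many vertices and an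
  irreflexive symmetric set of arcs, so that the edge \<open>{x, x'}\<close> is present iff
  \<open>(x, x')\<close> (equivalently \<open>(x', x)\<close>) is an arc.

  The type argument selects the dimension, \<open>\<real>\<^sup>n\<close> with \<open>n = CARD('n)\<close>. The map
  is not required to be injective, and only its values on the vertices matter.
\<close>

definition representable :: "'n::finite itself \<Rightarrow> 'a pair_pre_digraph \<Rightarrow> bool" where
  "representable _ G \<longleftrightarrow>
     (\<exists>f :: 'a \<Rightarrow> real ^ 'n.
        \<forall>x \<in> pverts G. \<forall>x' \<in> pverts G. \<forall>y \<in> pverts G. \<forall>y' \<in> pverts G.
          x \<noteq> x' \<longrightarrow> y \<noteq> y' \<longrightarrow>
            (norm (f x - f x') = norm (f y - f y') \<longleftrightarrow>
               ((x, x') \<in> parcs G \<and> (y, y') \<in> parcs G) \<or>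
               ((x, x') \<notin> parcs G \<and> (y, y') \<notin> parcs G)))"

end

theory Submission
  imports Defs
begin

text \<open>
  Let \<open>A\<close> be the adjacency matrix and \<open>S\<close> the hyperplane of vectors with coordinate sum zero.
  If \<open>\<lambda>\<close> is the maximum of \<open>x \<bullet> A x\<close> over the unit vectors of \<open>S\<close>, the quadratic form
  \<open>Q x = \<lambda> (x \<bullet> x) - x \<bullet> A x\<close> is positive semidefinite on \<open>S\<close> and vanishes at a maximiser.
  Its rank is therefore at most \<open>|G| - 2\<close>, so \<open>Q\<close> is the squared norm of a linear image of \<open>S\<close> in
  that dimension. Differences of coordinate vectors satisfy \<open>Q (e\<^sub>u - e\<^sub>v) = 2 \<lambda> + 2 A\<^sub>u\<^sub>v\<close>, which
  takes one value on edges and another on non-edges.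
\<close>

text \<open>Along the line \<open>x + t *\<^sub>R w\<close> the form is affine in \<open>t\<close>
  with slope \<open>2 * B w x\<close>; a nonzero slope would make it negative somewhere. The chosen
  \<open>t\<close> gives the value -1.\<close>

lemma bilinear_psd_null:
  fixes B :: "'v::real_vector \<Rightarrow> 'v \<Rightarrow> real"
  assumes B: "bilinear B" and sym: "\<And>x y. B x y = B y x"
    and S: "subspace S" and psd: "\<And>x. x \<in> S \<Longrightarrow> 0 \<le> B x x"
    and w: "w \<in> S" "B w w = 0" and x: "x \<in> S"
  shows "B w x = 0"
proof (rule ccontr)
  assume nz: "B w x \<noteq> 0"
  define t where "t = - (B x x + 1) / (2 * B w x)"
  have "0 \<le> B (x + t *\<^sub>R w) (x + t *\<^sub>R w)"
    by (intro psd subspace_add[OF S] subspace_scale[OF S] x w)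
  also have "\<dots> = B x x + 2 * t * B w x"
    using w(2) sym[of x w]
    by (simp add: bilinear_ladd[OF B] bilinear_radd[OF B] bilinear_lmul[OF B] bilinear_rmul[OF B])
  also have "\<dots> = -1"
    using nz by (simp add: t_def field_simps)
  finally show False by simp
qed

text \<open>Completing the square, one spanning vector at a time: subtracting the square attached to
  \<open>b\<close> leaves a semidefinite form \<open>C\<close> with \<open>b\<close> in its radical,
  to which induction on \<open>T\<close> applies.\<close>

lemma psd_form_as_sum_of_products:
  fixes B :: "'v::real_vector \<Rightarrow> 'v \<Rightarrow> real"
  assumes "finite T" "bilinear B" "\<And>x y. B x y = B y x" "\<And>x. x \<in> span T \<Longrightarrow> 0 \<le> B x x"
  shows "\<exists>g. \<forall>x\<in>span T. \<forall>y\<in>span T. B x y = (\<Sum>k\<in>T. g x k * g y k)"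
  using assms
proof (induction T arbitrary: B rule: finite_induct)
  case empty
  then show ?case by (simp add: bilinear_lzero)
next
  case (insert b T)
  note B = insert.prems(1) and sym = insert.prems(2) and psd = insert.prems(3)
  let ?U = "span (insert b T)"
  have bU: "b \<in> ?U" by (simp add: span_base)
  have null: "B b x = 0" if "B b b = 0" "x \<in> ?U" for x
    using bilinear_psd_null[OF B sym subspace_span psd bU] that by blast
  \<comment> \<open>If \<open>B b b = 0\<close>, the division by zero makes \<open>C = B\<close>, and \<open>b\<close> is already in the radical.\<close>
  define C where "C x y = B x y - B b x * B b y / B b b" for x y
  have C: "bilinear C"
    unfolding bilinear_def C_def
    by (auto intro!: linearI simp: bilinear_ladd[OF B] bilinear_radd[OF B] bilinear_lmul[OF B]
        bilinear_rmul[OF B] algebra_simps add_divide_distrib)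
  have Csym: "C x y = C y x" for x y
    by (simp add: C_def sym[of x y])
  have Cb: "C b x = 0" if "x \<in> ?U" for x
    using null[OF _ that] by (cases "B b b = 0") (auto simp: C_def)
  have Cpsd: "0 \<le> C x x" if x: "x \<in> ?U" for x
  proof (cases "B b b = 0")
    case True
    then show ?thesis using psd[OF x] by (simp add: C_def)
  next
    case False
    \<comment> \<open>The component of \<open>x\<close> that is \<open>B\<close>-orthogonal to
      \<open>b\<close>.\<close>
    define y where "y = x - (B b x / B b b) *\<^sub>R b"
    have "0 \<le> B y y"
      unfolding y_def by (intro psd span_diff span_scale x bU)
    also have "\<dots> = C x x"
      using False sym[of x b]
      by (simp add: y_def C_def bilinear_lsub[OF B] bilinear_rsub[OF B] bilinear_lmul[OF B]
          bilinear_rmul[OF B] field_simps)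
    finally show ?thesis .
  qed
  have sub: "span T \<subseteq> ?U" by (rule span_mono) auto
  obtain g where g: "\<And>x y. x \<in> span T \<Longrightarrow> y \<in> span T \<Longrightarrow> C x y = (\<Sum>k\<in>T. g x k * g y k)"
    using insert.IH[OF C Csym] Cpsd sub by blast
  have "\<forall>x\<in>?U. \<exists>k. x - k *\<^sub>R b \<in> span T"
    by (metis insertI1 span_breakdown_eq)
  then obtain k where k: "\<And>x. x \<in> ?U \<Longrightarrow> x - k x *\<^sub>R b \<in> span T" by metis
  \<comment> \<open>Coordinate \<open>b\<close> restores the subtracted square, and is 0 by division
    by zero if \<open>B b b = 0\<close>. The others may be read off at
    \<open>x - k x *\<^sub>R b\<close>, since \<open>C\<close> ignores multiples of
    \<open>b\<close>.\<close>
  define h where "h x j = (if j = b then B b x / sqrt (B b b) else g (x - k x *\<^sub>R b) j)" for x j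
  have "B x y = (\<Sum>j\<in>insert b T. h x j * h y j)" if x: "x \<in> ?U" and y: "y \<in> ?U" for x y
  proof -
    have "(\<Sum>j\<in>insert b T. h x j * h y j)
        = h x b * h y b + (\<Sum>j\<in>T. g (x - k x *\<^sub>R b) j * g (y - k y *\<^sub>R b) j)"
      using insert.hyps by (auto simp: h_def intro!: sum.cong)
    also have "(\<Sum>j\<in>T. g (x - k x *\<^sub>R b) j * g (y - k y *\<^sub>R b) j)
        = C (x - k x *\<^sub>R b) (y - k y *\<^sub>R b)"
      using g k x y by simp
    also have "\<dots> = C x y"
      using Cb[OF x] Cb[OF y] Cb[OF bU] Csym[of x b]
      by (simp add: bilinear_lsub[OF C] bilinear_rsub[OF C] bilinear_lmul[OF C] bilinear_rmul[OF C])
    also have "h x b * h y b = B b x * B b y / B b b"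
      using psd[OF bU] by (simp add: h_def)
    finally show ?thesis by (simp add: C_def)
  qed
  then show ?case by blast
qed

text \<open>The null vector \<open>w\<close> lies in the radical of \<open>B\<close> on
  \<open>S\<close>. Completing it to a basis of \<open>S\<close> and then discarding it saves one
  dimension.\<close>

lemma psd_form_as_inner:
  fixes B :: "'v::euclidean_space \<Rightarrow> 'v \<Rightarrow> real"
  assumes B: "bilinear B" and sym: "\<And>x y. B x y = B y x"
    and S: "subspace S" and psd: "\<And>x. x \<in> S \<Longrightarrow> 0 \<le> B x x"
    and w: "w \<in> S" "w \<noteq> 0" "B w w = 0" and dim: "dim S \<le> Suc CARD('n::finite)"
  shows "\<exists>F :: 'v \<Rightarrow> real ^ 'n. \<forall>x\<in>S. \<forall>y\<in>S. B x y = F x \<bullet> F y"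
proof -
  obtain T' where T': "{w} \<subseteq> T'" "T' \<subseteq> S" "independent T'" "S \<subseteq> span T'"
    using maximal_independent_subset_extend[of "{w}" S] w by auto
  define T where "T = T' - {w}"
  have fin: "finite T'" using T'(3) by (rule independent_imp_finite)
  have "card T' = dim S" using T' by (metis basis_card_eq_dim)
  then have card: "card T \<le> CARD('n)" "finite T"
    using dim T'(1) fin by (auto simp: T_def)
  have TS: "span T \<subseteq> S"
    using T'(2) by (intro span_minimal S) (auto simp: T_def)
  obtain g where g: "\<And>x y. x \<in> span T \<Longrightarrow> y \<in> span T \<Longrightarrow> B x y = (\<Sum>k\<in>T. g x k * g y k)"
    using psd_form_as_sum_of_products[OF card(2) B sym] psd TS by blast
  have "\<forall>x\<in>S. \<exists>k. x - k *\<^sub>R w \<in> span T"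
    using T' by (auto simp: T_def intro!: span_breakdown)
  then obtain k where k: "\<And>x. x \<in> S \<Longrightarrow> x - k x *\<^sub>R w \<in> span T" by metis
  obtain h :: "'v \<Rightarrow> 'n" where h: "inj_on h T"
    using card inj_on_iff_card_le[of T "UNIV :: 'n set"] by auto
  define F :: "'v \<Rightarrow> real ^ 'n" where
    "F x = (\<chi> i. if i \<in> h ` T then g (x - k x *\<^sub>R w) (inv_into T h i) else 0)" for x
  have "B x y = F x \<bullet> F y" if x: "x \<in> S" and y: "y \<in> S" for x y
  proof -
    have null: "B w z = 0" if "z \<in> S" for z
      using bilinear_psd_null[OF B sym S psd w(1,3) that] .
    have "F x \<bullet> F y = (\<Sum>i\<in>h ` T. F x $ i * F y $ i)"
      unfolding inner_vec_def by (rule sum.mono_neutral_cong_right) (auto simp: F_def)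
    also have "\<dots> = (\<Sum>j\<in>T. g (x - k x *\<^sub>R w) j * g (y - k y *\<^sub>R w) j)"
      using h by (subst sum.reindex) (auto simp: F_def intro!: sum.cong)
    also have "\<dots> = B (x - k x *\<^sub>R w) (y - k y *\<^sub>R w)"
      using g k x y by simp
    also have "\<dots> = B x y"
      using null[OF x] null[OF y] w(3) sym[of x w]
      by (simp add: bilinear_lsub[OF B] bilinear_rsub[OF B] bilinear_lmul[OF B] bilinear_rmul[OF B])
    finally show ?thesis by simp
  qed
  then show ?thesis by blast
qed

text \<open>Here the vertices form a whole type \<open>'k\<close>, so that the adjacency matrix can
  be typed. The hyperplane has dimension \<open>CARD('n) + 1\<close>, and the maximiser lowers this
  by one.\<close>

lemma two_distance_embedding:
  fixes E :: "'k::finite \<Rightarrow> 'k \<Rightarrow> bool"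
  assumes symE: "\<And>u v. E u v = E v u" and irr: "\<And>u. \<not> E u u"
    and card: "CARD('k) = CARD('n::finite) + 2"
  shows "\<exists>(f :: 'k \<Rightarrow> real ^ 'n) d. \<forall>u v. u \<noteq> v \<longrightarrow> (norm (f u - f v))\<^sup>2 = d + (if E u v then 2 else 0)"
proof -
  \<comment> \<open>Two distinct vertices give a nonzero vector of \<open>S\<close>, so its unit
    sphere \<open>K\<close> is nonempty and the maximum exists.\<close>
  have "\<exists>a b :: 'k. a \<noteq> b"
  proof (rule ccontr)
    assume "\<nexists>a b :: 'k. a \<noteq> b"
    then have "(UNIV :: 'k set) = {undefined}" by auto
    then have "CARD('k) = 1" by (metis is_singletonI is_singleton_altdef)
    then show False using card by simp
  qed
  then obtain a b :: 'k where two: "a \<noteq> b" by blast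
  define A :: "real ^ 'k ^ 'k" where "A = (\<chi> i j. if E i j then 1 else 0)"
  have Asym: "x \<bullet> (A *v y) = y \<bullet> (A *v x)" for x y
  proof -
    have "transpose A = A" by (simp add: A_def transpose_def vec_eq_iff symE)
    then show ?thesis by (metis dot_lmul_matrix inner_commute transpose_matrix_vector)
  qed
  define S :: "(real ^ 'k) set" where "S = {x. 1 \<bullet> x = 0}"
  have S: "subspace S" unfolding S_def by (rule subspace_hyperplane)
  have dimS: "dim S \<le> Suc CARD('n)"
    using card dim_hyperplane[of "1 :: real ^ 'k"] by (simp add: S_def)
  have diffS: "axis u 1 - axis v 1 \<in> S" for u v
    by (simp add: S_def inner_diff_right inner_axis)
  define K where "K = S \<inter> sphere 0 1"
  have "compact K"
    unfolding K_def by (intro closed_Int_compact closed_subspace S compact_sphere)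
  moreover have "K \<noteq> {}"
  proof -
    define z :: "real ^ 'k" where "z = axis a 1 - axis b 1"
    have "z $ a = 1" using two by (simp add: z_def axis_def)
    then have "z \<noteq> 0" by auto
    then have "(1 / norm z) *\<^sub>R z \<in> K"
      using diffS[of a b] by (simp add: K_def z_def subspace_scale[OF S])
    then show ?thesis by blast
  qed
  moreover have "continuous_on K (\<lambda>x. x \<bullet> (A *v x))"
    by (intro continuous_intros linear_continuous_on matrix_vector_mul_bounded_linear)
  ultimately obtain w where w: "w \<in> K" and wmax: "\<And>x. x \<in> K \<Longrightarrow> x \<bullet> (A *v x) \<le> w \<bullet> (A *v w)"
    using continuous_attains_sup by metis
  define l where "l = w \<bullet> (A *v w)"
  define B where "B x y = l * (x \<bullet> y) - x \<bullet> (A *v y)" for x y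
  have B: "bilinear B"
    unfolding bilinear_def B_def
    by (auto intro!: linearI simp: inner_simps matrix_vector_right_distrib
        matrix_vector_mult_scaleR algebra_simps)
  have sym: "B x y = B y x" for x y
    by (simp add: B_def Asym[of x] inner_commute)
  have psd: "0 \<le> B x x" if "x \<in> S" for x
  proof (cases "x = 0")
    case True
    then show ?thesis by (simp add: B_def)
  next
    case False
    define y where "y = (1 / norm x) *\<^sub>R x"
    have "y \<in> K" using False that by (simp add: K_def y_def subspace_scale[OF S])
    then have "0 \<le> B y y"
      using wmax[of y] by (simp add: B_def l_def K_def norm_eq_1)
    moreover have "B x x = (norm x)\<^sup>2 * B y y"
      using False by (simp add: y_def bilinear_lmul[OF B] bilinear_rmul[OF B] power2_eq_square)
    ultimately show ?thesis by simp
  qed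
  have wS: "w \<in> S" "w \<noteq> 0" "B w w = 0"
    using w by (auto simp: K_def B_def l_def norm_eq_1)
  obtain F :: "real ^ 'k \<Rightarrow> real ^ 'n" where F: "\<And>x y. x \<in> S \<Longrightarrow> y \<in> S \<Longrightarrow> B x y = F x \<bullet> F y"
    using psd_form_as_inner[OF B sym S psd wS dimS] by blast
  \<comment> \<open>Coordinate vectors lie outside \<open>S\<close>, where \<open>F\<close> is not
    controlled. Subtracting a fixed one moves them into \<open>S\<close> and keeps their
    differences.\<close>
  define p :: "'k \<Rightarrow> real ^ 'k" where "p u = axis u 1 - axis a 1" for u
  have "(norm (F (p u) - F (p v)))\<^sup>2 = 2 * l + (if E u v then 2 else 0)" if "u \<noteq> v" for u v
  proof -
    have ax: "axis i (1::real) $ j = 0" if "i \<noteq> j" for i j :: 'k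
      using that by (simp add: axis_def)
    have "(norm (F (p u) - F (p v)))\<^sup>2 = B (p u) (p u) + B (p v) (p v) - 2 * B (p u) (p v)"
      by (simp add: power2_norm_eq_inner F diffS p_def inner_diff inner_commute)
    also have "\<dots> = B (p u - p v) (p u - p v)"
      using sym[of "p u" "p v"] by (simp add: bilinear_lsub[OF B] bilinear_rsub[OF B])
    also have "p u - p v = axis u 1 - axis v 1" by (simp add: p_def)
    also have "B (axis u 1 - axis v 1) (axis u 1 - axis v 1) = 2 * l + (if E u v then 2 else 0)"
      using that irr symE[of u v] ax[of u v] ax[of v u]
      by (simp add: B_def A_def matrix_vector_mult_diff_distrib inner_diff inner_axis_axis
          matrix_vector_mul_component inner_axis' inner_axis)
    finally show ?thesis .
  qed
  then show ?thesis
    by (intro exI[of _ "\<lambda>u. F (p u)"] exI[of _ "2 * l"]) blast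
qed

theorem theorem1:
  fixes G :: "'a pair_pre_digraph"
  assumes "pair_graph G"
    and not_independent: "\<exists>u \<in> pverts G. \<exists>v \<in> pverts G. (u, v) \<in> parcs G"
    and not_complete: "\<exists>u \<in> pverts G. \<exists>v \<in> pverts G. u \<noteq> v \<and> (u, v) \<notin> parcs G"
    and dimension: "CARD('n::finite) = card (pverts G) - 2"
  shows "representable TYPE('n) G"
proof -
  interpret pair_graph G by fact
  \<comment> \<open>The subtraction in \<open>dimension\<close> is truncated, but
    \<open>CARD('n)\<close> is positive. Hence \<open>'n option option\<close> has exactly as many
    elements as \<open>G\<close> has vertices.\<close>
  have "card (pverts G) > 2"
    using dimension zero_less_card_finite[where 'a='n] by linarith
  then have card: "card (pverts G) = CARD('n option option)"
    using dimension by (simp add: card_UNIV_option)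
  then obtain h :: "'a \<Rightarrow> 'n option option" where h: "bij_betw h (pverts G) UNIV"
    using finite_same_card_bij[of "pverts G" "UNIV :: 'n option option set"] by auto
  define r where "r = inv_into (pverts G) h"
  have rh: "r (h x) = x" if "x \<in> pverts G" for x
    using h that by (simp add: r_def bij_betw_inv_into_left)
  have "\<exists>(f :: 'n option option \<Rightarrow> real ^ 'n) d. \<forall>u v. u \<noteq> v \<longrightarrow>
      (norm (f u - f v))\<^sup>2 = d + (if (r u, r v) \<in> parcs G then 2 else 0)"
    by (rule two_distance_embedding) (auto simp: card_UNIV_option arcs_symmetric dest: no_loops)
  then obtain f :: "'n option option \<Rightarrow> real ^ 'n" and d where
    f: "\<And>u v. u \<noteq> v \<Longrightarrow> (norm (f u - f v))\<^sup>2 = d + (if (r u, r v) \<in> parcs G then 2 else 0)"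
    by blast
  have f': "(norm (f (h x) - f (h y)))\<^sup>2 = d + (if (x, y) \<in> parcs G then 2 else 0)"
    if "x \<in> pverts G" "y \<in> pverts G" "x \<noteq> y" for x y
    using f[of "h x" "h y"] rh that by metis
  \<comment> \<open>It suffices to compare squares, which are \<open>d + 2\<close> on edges and
    \<open>d\<close> on non-edges.\<close>
  have eq: "norm u = norm v \<longleftrightarrow> (norm u)\<^sup>2 = (norm v)\<^sup>2" for u v :: "real ^ 'n"
    by simp
  show ?thesis
    unfolding representable_def eq
    by (intro exI[of _ "\<lambda>x. f (h x)"]) (auto simp: f')
qed

end
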